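(* There is an algorithm that, given positive real numbers $\ell_1,\dots,\ell_n$ (the lengths of the $n$ segments of a carpenter's ruler), computes in $O(n\log n)$ time the shortest length into which the ruler can be wrapped, i.e. the quantity \[ W(\ell_1,\dots,\ell_n)=\min \max(t_1,\dots,t_m), \] where the minimum ranges over all $m\ge 1$ and all partitions of the sequence $\ell_1,\dots,\ell_n$ into $m$ nonempty consecutive blocks with block sums $t_1,\dots,t_m$ satisfying $t_1\le t_2\le\cdots\le t_{m-1}$ (no constraint is placed on $t_m$).
   Context: A carpenter's ruler consists of $n$ segments of given positive lengths $\ell_1,\dots,\ell_n$ joined end to end by hinges; segments have width $0$ and folds are points. Wrapping the ruler means folding some subset of the hinges by 180 degrees, all in the same rotational direction (all clockwise or all counter-clockwise), so that the ruler lies on a line; the length of the wrapping is the length of the interval it occupies. If the folded hinges split the ruler into consecutive pieces of total lengths $t_1,\dots,t_m$ (from one end to the other), such a same-direction wrapping exists exactly when $t_1\le t_2\le\cdots\le t_{m-1}$ (the last piece may be shorter, in which case it lies inside the previous turn), and its length is then $\max(t_1,\dots,t_m)$. Running times are in a model where arithmetic operations and comparisons on the input numbers take constant time. *)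

theory Defs
  imports Complex_Main "HOL-Library.Landau_Symbols"
begin

section \<open>Wrappings of a ruler\<close>

text \<open>A wrapping is given by the list of its consecutive blocks of segments.\<close>

definition wrappings :: "real list \<Rightarrow> real list list set" where
  "wrappings ls = {bs. bs \<noteq> [] \<and> [] \<notin> set bs \<and> concat bs = ls \<and> sorted (butlast (map sum_list bs))}"

definition wrapping_length :: "real list list \<Rightarrow> real" where
  "wrapping_length bs = Max (set (map sum_list bs))"

definition shortest_wrapping :: "real list \<Rightarrow> real" where
  "shortest_wrapping ls = Min (wrapping_length ` wrappings ls)"

text \<open>For a nonempty ruler the minimum ranges over a finite nonempty set.\<close>

lemma length_le_length_concat: "[] \<notin> set bs \<Longrightarrow> length bs \<le> length (concat bs)"
proof (induction bs)
  case (Cons b bs)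
  then have "length b \<ge> 1" by (cases b) auto
  with Cons show ?case by auto
qed simp

lemma finite_wrappings: "finite (wrappings ls)"
proof (rule finite_subset)
  let ?B = "{b. set b \<subseteq> set ls \<and> length b \<le> length ls}"
  show "wrappings ls \<subseteq> {bs. set bs \<subseteq> ?B \<and> length bs \<le> length ls}"
  proof
    fix bs assume "bs \<in> wrappings ls"
    then have bs: "[] \<notin> set bs" "concat bs = ls" by (auto simp: wrappings_def)
    have "length b \<le> length (concat bs)" if "b \<in> set bs" for b
      using that by (auto simp: length_concat intro: member_le_sum_list)
    then show "bs \<in> {bs. set bs \<subseteq> ?B \<and> length bs \<le> length ls}"
      using length_le_length_concat[OF bs(1)] bs(2) by auto
  qed
  show "finite {bs. set bs \<subseteq> ?B \<and> length bs \<le> length ls}"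
    by (intro finite_lists_length_le) auto
qed

lemma wrappings_nonempty: "ls \<noteq> [] \<Longrightarrow> wrappings ls \<noteq> {}"
  by (auto simp: wrappings_def intro!: exI[of _ "[ls]"])

section \<open>A real RAM\<close>

text \<open>
  A uniform real RAM, presented as a structured imperative language.  The store consists of
  zero-initialised arrays of natural numbers, which serve as counters and addresses, and arrays of
  real numbers; a scalar variable is cell 0 of an array.  Counters can only be added, subtracted
  and compared, real numbers can only be combined by field operations and compared: there is no
  rounding of a real to a counter, and the only constants of real type are integers, so that
  a program cannot contain an arbitrary real as advice.  As in HOL, subtraction of counters
  truncates at 0 and division by 0 yields 0.
\<close>

type_synonym vname = string

record store =
  nats :: "vname \<Rightarrow> nat \<Rightarrow> nat"
  reals :: "vname \<Rightarrow> nat \<Rightarrow> real"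

datatype nexp = NConst nat | NCell vname nexp | NAdd nexp nexp | NSub nexp nexp

datatype rexp = RConst int | RCell vname nexp
  | RAdd rexp rexp | RSub rexp rexp | RMul rexp rexp | RDiv rexp rexp

datatype bexp = NLess nexp nexp | RLess rexp rexp | BNot bexp | BAnd bexp bexp

datatype com = Skip
  | NAssign vname nexp nexp
  | RAssign vname nexp rexp
  | Seq com com
  | Cond bexp com com
  | While bexp com

fun nval :: "nexp \<Rightarrow> store \<Rightarrow> nat" where
  "nval (NConst k) s = k"
| "nval (NCell x e) s = nats s x (nval e s)"
| "nval (NAdd e1 e2) s = nval e1 s + nval e2 s"
| "nval (NSub e1 e2) s = nval e1 s - nval e2 s"

fun rval :: "rexp \<Rightarrow> store \<Rightarrow> real" where
  "rval (RConst k) s = of_int k"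
| "rval (RCell x e) s = reals s x (nval e s)"
| "rval (RAdd e1 e2) s = rval e1 s + rval e2 s"
| "rval (RSub e1 e2) s = rval e1 s - rval e2 s"
| "rval (RMul e1 e2) s = rval e1 s * rval e2 s"
| "rval (RDiv e1 e2) s = rval e1 s / rval e2 s"

fun bval :: "bexp \<Rightarrow> store \<Rightarrow> bool" where
  "bval (NLess e1 e2) s = (nval e1 s < nval e2 s)"
| "bval (RLess e1 e2) s = (rval e1 s < rval e2 s)"
| "bval (BNot b) s = (\<not> bval b s)"
| "bval (BAnd b1 b2) s = (bval b1 s \<and> bval b2 s)"

text \<open>Every constant, memory access, arithmetic operation, comparison, connective, assignment
  and branch takes one unit of time.\<close>

fun ncost :: "nexp \<Rightarrow> nat" where
  "ncost (NConst k) = 1"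
| "ncost (NCell x e) = 1 + ncost e"
| "ncost (NAdd e1 e2) = 1 + ncost e1 + ncost e2"
| "ncost (NSub e1 e2) = 1 + ncost e1 + ncost e2"

fun rcost :: "rexp \<Rightarrow> nat" where
  "rcost (RConst k) = 1"
| "rcost (RCell x e) = 1 + ncost e"
| "rcost (RAdd e1 e2) = 1 + rcost e1 + rcost e2"
| "rcost (RSub e1 e2) = 1 + rcost e1 + rcost e2"
| "rcost (RMul e1 e2) = 1 + rcost e1 + rcost e2"
| "rcost (RDiv e1 e2) = 1 + rcost e1 + rcost e2"

fun bcost :: "bexp \<Rightarrow> nat" where
  "bcost (NLess e1 e2) = 1 + ncost e1 + ncost e2"
| "bcost (RLess e1 e2) = 1 + rcost e1 + rcost e2"
| "bcost (BNot b) = 1 + bcost b"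
| "bcost (BAnd b1 b2) = 1 + bcost b1 + bcost b2"

definition write_nat :: "vname \<Rightarrow> nat \<Rightarrow> nat \<Rightarrow> store \<Rightarrow> store" where
  "write_nat x i v s = s\<lparr>nats := (nats s)(x := (nats s x)(i := v))\<rparr>"

definition write_real :: "vname \<Rightarrow> nat \<Rightarrow> real \<Rightarrow> store \<Rightarrow> store" where
  "write_real x i v s = s\<lparr>reals := (reals s)(x := (reals s x)(i := v))\<rparr>"

text \<open>\<open>exec c s t s'\<close>: started in \<open>s\<close>, the program \<open>c\<close> halts in \<open>s'\<close> after time \<open>t\<close>.\<close>

inductive exec :: "com \<Rightarrow> store \<Rightarrow> nat \<Rightarrow> store \<Rightarrow> bool" where
  Skip: "exec Skip s 1 s"
| NAssign: "exec (NAssign x i e) s (1 + ncost i + ncost e) (write_nat x (nval i s) (nval e s) s)"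
| RAssign: "exec (RAssign x i e) s (1 + ncost i + rcost e) (write_real x (nval i s) (rval e s) s)"
| Seq: "exec c1 s t1 s' \<Longrightarrow> exec c2 s' t2 s'' \<Longrightarrow> exec (Seq c1 c2) s (t1 + t2) s''"
| CondTrue: "bval b s \<Longrightarrow> exec c1 s t s' \<Longrightarrow> exec (Cond b c1 c2) s (1 + bcost b + t) s'"
| CondFalse: "\<not> bval b s \<Longrightarrow> exec c2 s t s' \<Longrightarrow> exec (Cond b c1 c2) s (1 + bcost b + t) s'"
| WhileFalse: "\<not> bval b s \<Longrightarrow> exec (While b c) s (1 + bcost b) s"
| WhileTrue: "bval b s \<Longrightarrow> exec c s t1 s' \<Longrightarrow> exec (While b c) s' t2 s''
    \<Longrightarrow> exec (While b c) s (1 + bcost b + t1 + t2) s''"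

inductive_cases exec_elims:
  "exec Skip s t s'" "exec (NAssign x i e) s t s'" "exec (RAssign x i e) s t s'"
  "exec (Seq c1 c2) s t s'" "exec (Cond b c1 c2) s t s'" "exec (While b c) s t s'"

lemma exec_deterministic: "exec c s t s' \<Longrightarrow> exec c s u r \<Longrightarrow> u = t \<and> r = s'"
proof (induction arbitrary: u r rule: exec.induct)
  case (Skip s)
  from Skip.prems show ?case by (rule exec_elims(1)) simp
next
  case (NAssign x i e s)
  from NAssign.prems show ?case by (rule exec_elims(2)) simp
next
  case (RAssign x i e s)
  from RAssign.prems show ?case by (rule exec_elims(3)) simp
next
  case (Seq c1 s t1 s' c2 t2 s'')
  from Seq.prems obtain v1 v2 r' where r: "u = v1 + v2" "exec c1 s v1 r'" "exec c2 r' v2 r"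
    by (rule exec_elims(4))
  from Seq.IH(1)[OF r(2)] have r': "v1 = t1" "r' = s'" by simp_all
  from Seq.IH(2)[of v2 r] r r' show ?case by simp
next
  case (CondTrue b s c1 t s' c2)
  from CondTrue.prems obtain v where v: "u = 1 + bcost b + v" "exec c1 s v r"
    by (rule exec_elims(5)) (use CondTrue.hyps(1) in simp_all)
  from CondTrue.IH[OF v(2)] v(1) show ?case by simp
next
  case (CondFalse b s c2 t s' c1)
  from CondFalse.prems obtain v where v: "u = 1 + bcost b + v" "exec c2 s v r"
    by (rule exec_elims(5)) (use CondFalse.hyps(1) in simp_all)
  from CondFalse.IH[OF v(2)] v(1) show ?case by simp
next
  case (WhileFalse b s c)
  from WhileFalse.prems show ?case by (rule exec_elims(6)) (use WhileFalse.hyps in simp_all)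
next
  case (WhileTrue b s c t1 s' t2 s'')
  from WhileTrue.prems obtain v1 v2 r' where
    r: "u = 1 + bcost b + v1 + v2" "exec c s v1 r'" "exec (While b c) r' v2 r"
    by (rule exec_elims(6)) (use WhileTrue.hyps(1) in simp_all)
  from WhileTrue.IH(1)[OF r(2)] have r': "v1 = t1" "r' = s'" by simp_all
  from WhileTrue.IH(2)[of v2 r] r r' show ?case by simp
qed

definition input_store :: "real list \<Rightarrow> store" where
  "input_store ls = \<lparr>nats = (\<lambda>x i. if x = ''n'' \<and> i = 0 then length ls else 0),
                     reals = (\<lambda>x i. if x = ''l'' \<and> i < length ls then ls ! i else 0)\<rparr>"

definition output_of :: "store \<Rightarrow> real" where
  "output_of s = reals s ''out'' 0"

end

theory Submission
  imports Defs
begin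

text \<open>
  Let \<open>S i\<close> be the prefix sums and \<open>f i\<close> the least possible last block sum over all partitions of
  the first \<open>i\<close> segments into blocks with nondecreasing sums.  A last block \<open>(j, i]\<close> is admissible
  iff \<open>f j \<le> S i - S j\<close>, so \<open>f i = S i - S p\<close> for the largest \<open>p < i\<close> with \<open>S p + f p \<le> S i\<close>, and
  the shortest wrapping has length \<open>min\<^sub>j max (f j) (S n - S j)\<close>.  Since \<open>S\<close> is increasing, an
  index \<open>j\<close> that has become admissible stays so, and \<open>j\<close> is useless once there is a later index
  whose key \<open>S k + f k\<close> is at most that of \<open>j\<close>.  A queue of indices with increasing keys
  therefore yields every \<open>p\<close> in amortised constant time, and the whole computation is even linear.
\<close>

section \<open>The recurrence\<close>

definition prefix_sum :: "real list \<Rightarrow> nat \<Rightarrow> real" where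
  "prefix_sum ls k = sum_list (take k ls)"

text \<open>A relation rather than a recursive function, so that it can be asserted of array
  contents, which are arbitrary beyond \<open>n\<close>. As prefix sums of positive lengths
  increase, the largest admissible \<open>p\<close> leaves the smallest last block.\<close>

definition last_blocks :: "(nat \<Rightarrow> real) \<Rightarrow> (nat \<Rightarrow> real) \<Rightarrow> nat \<Rightarrow> bool" where
  "last_blocks S f n \<longleftrightarrow> f 0 = 0 \<and>
     (\<forall>i\<in>{1..n}. \<exists>p<i. f i = S i - S p \<and> S p + f p \<le> S i \<and>
        (\<forall>j<i. S j + f j \<le> S i \<longrightarrow> j \<le> p))"

text \<open>These are the blocks before the unconstrained final block of a wrapping; the empty list
  is included to cover wrappings with a single block.\<close>

definition sorted_blocks :: "real list \<Rightarrow> real list list set" where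
  "sorted_blocks xs = {bs. [] \<notin> set bs \<and> concat bs = xs \<and> sorted (map sum_list bs)}"

text \<open>The leading \<open>0\<close> makes the empty partition compatible with any first block.\<close>

definition last_sum :: "real list list \<Rightarrow> real" where
  "last_sum bs = last (0 # map sum_list bs)"

lemma last_sum_simps [simp]: "last_sum [] = 0" "last_sum (bs @ [b]) = sum_list b"
  by (simp_all add: last_sum_def)

lemma prefix_sum_0 [simp]: "prefix_sum ls 0 = 0"
  by (simp add: prefix_sum_def)

lemma prefix_sum_Suc: "k < length ls \<Longrightarrow> prefix_sum ls (Suc k) = prefix_sum ls k + ls ! k"
  by (simp add: prefix_sum_def take_Suc_conv_app_nth)

lemma prefix_sum_mono:
  assumes "\<forall>l\<in>set ls. 0 < l" "j \<le> k"
  shows "prefix_sum ls j \<le> prefix_sum ls k"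
proof -
  have "take k ls = take j ls @ take (k - j) (drop j ls)"
    using assms(2) by (metis le_add_diff_inverse take_add)
  moreover have "sum_list (take (k - j) (drop j ls)) \<ge> 0"
    using assms(1) by (intro sum_list_nonneg) (meson in_set_dropD in_set_takeD less_imp_le)
  ultimately show ?thesis by (simp add: prefix_sum_def)
qed

lemma prefix_sum_strict_mono:
  assumes "\<forall>l\<in>set ls. 0 < l" "j < k" "k \<le> length ls"
  shows "prefix_sum ls j < prefix_sum ls k"
proof -
  have "prefix_sum ls j < prefix_sum ls (Suc j)"
    using assms by (simp add: prefix_sum_Suc)
  also have "\<dots> \<le> prefix_sum ls k"
    using assms by (intro prefix_sum_mono) auto
  finally show ?thesis .
qed

lemma take_append_drop_take: "j \<le> k \<Longrightarrow> take j xs @ drop j (take k xs) = take k xs"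
  by (metis append_take_drop_id min.absorb1 take_take)

lemma sum_list_drop_take:
  assumes "j \<le> k"
  shows "sum_list (drop j (take k ls)) = prefix_sum ls k - prefix_sum ls j"
  using arg_cong[OF take_append_drop_take[OF assms, of ls], of sum_list]
  by (simp add: prefix_sum_def del: drop_take)

lemma sorted_le_last: "sorted xs \<Longrightarrow> x \<in> set xs \<Longrightarrow> x \<le> last (0 # xs)"
  by (induction xs rule: rev_induct) (auto simp: sorted_append)

lemma sorted_blocks_snoc:
  "bs \<in> sorted_blocks xs \<Longrightarrow> b \<noteq> [] \<Longrightarrow> last_sum bs \<le> sum_list b \<Longrightarrow>
    bs @ [b] \<in> sorted_blocks (xs @ b)"
  by (auto simp: sorted_blocks_def sorted_append last_sum_def
      dest!: sorted_le_last[of "map sum_list bs"] intro: order_trans)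

text \<open>A partition attaining \<open>f p\<close> can be extended by the block from
  \<open>p\<close> to \<open>i\<close>: the inequality in the recurrence says that this block is at
  least \<open>f p\<close>.\<close>

lemma last_blocks_attained:
  assumes "last_blocks (prefix_sum ls) f n" "i \<le> n" "n \<le> length ls"
  shows "\<exists>bs\<in>sorted_blocks (take i ls). last_sum bs = f i"
  using assms(2)
proof (induction i rule: less_induct)
  case (less i)
  show ?case
  proof (cases "i = 0")
    case True
    then show ?thesis
      using assms(1) by (auto simp: sorted_blocks_def last_blocks_def intro!: exI[of _ "[]"])
  next
    case False
    then have "i \<in> {1..n}" using less.prems by simp
    then obtain p where p: "p < i" "f i = prefix_sum ls i - prefix_sum ls p"
        "prefix_sum ls p + f p \<le> prefix_sum ls i"
      using assms(1) unfolding last_blocks_def by blast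
    obtain bs where bs: "bs \<in> sorted_blocks (take p ls)" "last_sum bs = f p"
      using less.IH[of p] p(1) less.prems by auto
    let ?b = "drop p (take i ls)"
    have "bs @ [?b] \<in> sorted_blocks (take p ls @ ?b)"
    proof (rule sorted_blocks_snoc[OF bs(1)])
      show "?b \<noteq> []" using p(1) less.prems assms(3) by simp
      show "last_sum bs \<le> sum_list ?b" using bs(2) p by (simp add: sum_list_drop_take del: drop_take)
    qed
    moreover have "take p ls @ ?b = take i ls"
      using p(1) by (intro take_append_drop_take) simp
    ultimately have "bs @ [?b] \<in> sorted_blocks (take i ls)" by simp
    moreover have "last_sum (bs @ [?b]) = f i" using p(1,2) by (simp add: sum_list_drop_take del: drop_take)
    ultimately show ?thesis by blast
  qed
qed

text \<open>Exchange argument: if \<open>j\<close> is where the last block starts, then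
  \<open>f j\<close> is at most the sum before it, so \<open>j\<close> is admissible in the
  recurrence. Hence \<open>j\<close> is at most \<open>p\<close>, and the later start
  \<open>p\<close> gives a block that is no larger.\<close>

lemma last_blocks_le:
  assumes "last_blocks (prefix_sum ls) f n" "i \<le> n" "n \<le> length ls" "\<forall>l\<in>set ls. 0 < l"
    and "bs \<in> sorted_blocks (take i ls)"
  shows "f i \<le> last_sum bs"
  using assms(2,5)
proof (induction bs arbitrary: i rule: rev_induct)
  case Nil
  then have "i = 0" using assms(3) by (cases ls) (auto simp: sorted_blocks_def)
  then show ?case using assms(1) by (simp add: last_blocks_def)
next
  case (snoc b bs)
  define j where "j = length (concat bs)"
  have *: "concat bs @ b = take i ls" "b \<noteq> []" "sorted (map sum_list bs)" "[] \<notin> set bs"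
    using snoc.prems by (auto simp: sorted_blocks_def sorted_append)
  have "length (concat bs @ b) = i"
    using *(1) snoc.prems(1) assms(3) by simp
  then have ji: "j < i" using *(2) by (cases b) (auto simp: j_def)
  have cj: "concat bs = take j ls"
    using *(1) ji by (metis append_eq_conv_conj j_def less_imp_le min.absorb1 take_take)
  have "b = drop j (take i ls)"
    using *(1) by (metis append_eq_conv_conj j_def)
  then have sb: "sum_list b = prefix_sum ls i - prefix_sum ls j"
    using ji by (simp add: sum_list_drop_take)
  have "f j \<le> last_sum bs"
    using snoc.IH[of j] ji snoc.prems(1) * cj by (auto simp: sorted_blocks_def)
  also have "\<dots> \<le> sum_list b"
  \<comment> \<open>For empty \<open>bs\<close> sortedness compares nothing; the default value
    \<open>0\<close> of \<open>last_sum\<close> then asks for a nonnegative block sum.\<close>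
  proof (cases bs rule: rev_cases)
    case Nil
    have "prefix_sum ls j \<le> prefix_sum ls i" using assms(4) ji by (intro prefix_sum_mono) auto
    then show ?thesis using Nil sb by simp
  next
    case (snoc bs' b')
    then show ?thesis using snoc.prems(2) \<open>bs @ [b] \<in> _\<close> by (auto simp: sorted_blocks_def sorted_append)
  qed
  finally have fj: "prefix_sum ls j + f j \<le> prefix_sum ls i" using sb by simp
  have "i \<in> {1..n}" using ji snoc.prems(1) by simp
  then obtain p where p: "p < i" "f i = prefix_sum ls i - prefix_sum ls p" "j \<le> p"
    using assms(1) ji fj unfolding last_blocks_def by blast
  have "prefix_sum ls j \<le> prefix_sum ls p" using assms(4) p by (intro prefix_sum_mono) auto
  then show ?case using p sb by simp
qed

text \<open>Sortedness makes the last sum of \<open>bs\<close> its largest one; for empty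
  \<open>bs\<close> the default \<open>0\<close> cannot exceed the sum of \<open>b\<close>.\<close>

lemma wrapping_length_snoc:
  assumes "bs \<in> sorted_blocks xs" "b \<noteq> []" "\<forall>l\<in>set b. 0 < l"
  shows "wrapping_length (bs @ [b]) = max (last_sum bs) (sum_list b)"
proof (cases bs rule: rev_cases)
  case Nil
  have "0 \<le> sum_list b" using assms(3) by (intro sum_list_nonneg) auto
  then show ?thesis using Nil by (simp add: wrapping_length_def)
next
  case (snoc cs c)
  have "\<forall>x\<in>set (map sum_list cs). x \<le> sum_list c"
    using assms(1) snoc by (auto simp: sorted_blocks_def sorted_append)
  then show ?thesis
    unfolding wrapping_length_def using snoc by (intro Max_eqI) auto
qed

lemma wrappings_snoc_iff:
  "bs @ [b] \<in> wrappings ls \<longleftrightarrow> b \<noteq> [] \<and> (\<exists>xs. ls = xs @ b \<and> bs \<in> sorted_blocks xs)"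
  by (auto simp: wrappings_def sorted_blocks_def butlast_append map_butlast)

text \<open>Here \<open>j\<close> counts the segments before the final block. For fixed
  \<open>j\<close> the length is monotone in the last sum of the preceding blocks, so the least such
  sum \<open>f j\<close> is the best choice.\<close>

lemma shortest_wrapping_eq:
  assumes f: "last_blocks (prefix_sum ls) f (length ls)"
    and pos: "\<forall>l\<in>set ls. 0 < l" and ne: "ls \<noteq> []"
  shows "shortest_wrapping ls =
    Min ((\<lambda>j. max (f j) (prefix_sum ls (length ls) - prefix_sum ls j)) ` {..<length ls})"
    (is "_ = Min (?v ` _)")
proof -
  have up: "\<exists>ws\<in>wrappings ls. wrapping_length ws = ?v j" if j: "j < length ls" for j
  proof -
    obtain bs where bs: "bs \<in> sorted_blocks (take j ls)" "last_sum bs = f j"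
      using last_blocks_attained[OF f, of j] j by auto
    have "wrapping_length (bs @ [drop j ls]) = ?v j"
      using bs j pos sum_list_drop_take[of j "length ls" ls]
      by (subst wrapping_length_snoc) (auto dest: in_set_dropD)
    moreover have "bs @ [drop j ls] \<in> wrappings ls"
      using bs j by (auto simp: wrappings_snoc_iff intro!: exI[of _ "take j ls"])
    ultimately show ?thesis by blast
  qed
  have lo: "\<exists>j<length ls. ?v j \<le> wrapping_length ws" if ws: "ws \<in> wrappings ls" for ws
  proof -
    obtain bs b where wsb: "ws = bs @ [b]"
      using ws by (cases ws rule: rev_cases) (auto simp: wrappings_def)
    then obtain xs where xs: "b \<noteq> []" "ls = xs @ b" "bs \<in> sorted_blocks xs"
      using ws by (auto simp: wrappings_snoc_iff)
    have "wrapping_length ws = max (last_sum bs) (sum_list b)"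
      using wsb xs pos by (auto intro!: wrapping_length_snoc)
    moreover have "f (length xs) \<le> last_sum bs"
      using xs by (intro last_blocks_le[OF f _ _ pos]) auto
    moreover have "sum_list b = prefix_sum ls (length ls) - prefix_sum ls (length xs)"
      using xs by (simp add: prefix_sum_def)
    ultimately show ?thesis using xs by (intro exI[of _ "length xs"]) auto
  qed
  show ?thesis
    unfolding shortest_wrapping_def
  proof (rule Min_eqI)
    show "Min (?v ` {..<length ls}) \<le> y" if "y \<in> wrapping_length ` wrappings ls" for y
    proof -
      obtain j where "j < length ls" "?v j \<le> y" using \<open>y \<in> _\<close> lo by blast
      then show ?thesis by (intro order_trans[OF Min_le[of _ "?v j"]]) auto
    qed
    have "Min (?v ` {..<length ls}) \<in> ?v ` {..<length ls}"
      using ne by (intro Min_in) auto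
    then show "Min (?v ` {..<length ls}) \<in> wrapping_length ` wrappings ls"
      using up by force
  qed (simp add: finite_wrappings)
qed

section \<open>The monotone queue\<close>

text \<open>Cells \<open>h, \<dots>, t\<close> of \<open>q\<close> hold indices below \<open>m\<close> with increasing keys \<open>g\<close>; every index in \<open>J\<close>
  beyond the front of the queue is superseded by a later queued index whose key is no larger.\<close>

definition mono_queue :: "(nat \<Rightarrow> real) \<Rightarrow> nat \<Rightarrow> nat set \<Rightarrow> (nat \<Rightarrow> nat) \<Rightarrow> nat \<Rightarrow> nat \<Rightarrow> bool" where
  "mono_queue g m J q h t \<longleftrightarrow> h \<le> t \<and> (\<forall>a. h \<le> a \<and> a \<le> t \<longrightarrow> q a < m) \<and>
     (\<forall>a b. h \<le> a \<and> a < b \<and> b \<le> t \<longrightarrow> q a < q b \<and> g (q a) < g (q b)) \<and>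
     (\<forall>j\<in>J. j \<le> q h \<or> (\<exists>a. h \<le> a \<and> a \<le> t \<and> j \<le> q a \<and> g (q a) \<le> g j))"

text \<open>Lets the arrays \<open>s\<close> and \<open>f\<close> be written at a fresh index
  without disturbing the queue.\<close>

lemma mono_queue_cong:
  "mono_queue g m {..<m} q h t \<Longrightarrow> (\<And>k. k < m \<Longrightarrow> g' k = g k) \<Longrightarrow> mono_queue g' m {..<m} q h t"
  unfolding mono_queue_def by auto

text \<open>Whatever the old front covered lies at or before it, hence before the new front, as
  queued indices increase.\<close>

lemma mono_queue_pop_front:
  assumes "mono_queue g m J q h t" "h < t"
  shows "mono_queue g m J q (Suc h) t"
proof -
  have 1: "q h < q (Suc h)" using assms unfolding mono_queue_def by auto
  have 2: "j \<le> q (Suc h) \<or> (\<exists>a. Suc h \<le> a \<and> a \<le> t \<and> j \<le> q a \<and> g (q a) \<le> g j)" if "j \<in> J" for j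
  proof -
    have "j \<le> q h \<or> (\<exists>a. h \<le> a \<and> a \<le> t \<and> j \<le> q a \<and> g (q a) \<le> g j)"
      using assms(1) that unfolding mono_queue_def by simp
    then consider "j \<le> q h" | a where "h \<le> a" "a \<le> t" "j \<le> q a" "g (q a) \<le> g j"
      by blast
    then show ?thesis
    proof cases
      case 2
      then show ?thesis using 1 by (cases "a = h") (auto intro!: exI[of _ a])
    qed (use 1 in auto)
  qed
  show ?thesis using assms 2 unfolding mono_queue_def by auto
qed

text \<open>Once the second key exceeds \<open>x\<close>, so do all later ones. An admissible index
  beyond the front would be superseded by one of them, whose key would be at most \<open>x\<close>.
  So the front bounds all admissible indices.\<close>

lemma mono_queue_front:
  assumes "mono_queue g m {..<m} q h t" "h < t \<Longrightarrow> x < g (q (Suc h))" "j < m" "g j \<le> x"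
  shows "j \<le> q h"
proof (rule ccontr)
  assume "\<not> j \<le> q h"
  then obtain a where a: "h \<le> a" "a \<le> t" "j \<le> q a" "g (q a) \<le> g j"
    using assms unfolding mono_queue_def by auto
  then have "a \<noteq> h" using \<open>\<not> j \<le> q h\<close> by auto
  then have "Suc h \<le> a" "h < t" using a by auto
  then have "g (q (Suc h)) \<le> g (q a)"
    using assms(1) a unfolding mono_queue_def by (cases "a = Suc h") (auto intro!: less_imp_le)
  then show False using assms(2,4) a \<open>h < t\<close> by auto
qed

text \<open>Only indices with key below \<open>c\<close> must stay covered, and an entry with key at
  least \<open>c\<close> supersedes none of them. In use, \<open>c\<close> is the key of the index
  about to be pushed.\<close>

lemma mono_queue_pop_back:
  assumes "mono_queue g m {j. j < m \<and> g j < c} q h t" "c \<le> g (q t)" "h < t"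
  shows "mono_queue g m {j. j < m \<and> g j < c} q h (t - 1)"
proof -
  have "\<exists>a. h \<le> a \<and> a \<le> t - 1 \<and> j \<le> q a \<and> g (q a) \<le> g j"
    if "g j < c" "h \<le> a" "a \<le> t" "j \<le> q a" "g (q a) \<le> g j" for j a
  proof -
    have "a \<noteq> t" using that assms(2) by auto
    then show ?thesis using that by (intro exI[of _ a]) auto
  qed
  moreover have "j \<le> q h \<or> (\<exists>a. h \<le> a \<and> a \<le> t \<and> j \<le> q a \<and> g (q a) \<le> g j)"
    if "j < m" "g j < c" for j
    using assms(1) that unfolding mono_queue_def by simp
  ultimately have "j \<le> q h \<or> (\<exists>a. h \<le> a \<and> a \<le> t - 1 \<and> j \<le> q a \<and> g (q a) \<le> g j)"
    if "j < m" "g j < c" for j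
    using that by meson
  then show ?thesis using assms(1,3) unfolding mono_queue_def by auto
qed

text \<open>The new entry \<open>m\<close> supersedes every index whose key is at least
  \<open>g m\<close>, which restores the cover of all indices.\<close>

lemma mono_queue_push:
  assumes "mono_queue g m {j. j < m \<and> g j < g m} q h t" "g (q t) < g m"
  shows "mono_queue g (Suc m) {..<Suc m} (q(Suc t := m)) h (Suc t)"
proof -
  let ?q = "q(Suc t := m)"
  have ht: "h \<le> t" and lt: "\<And>a. h \<le> a \<Longrightarrow> a \<le> t \<Longrightarrow> q a < m"
    and inc: "\<And>a b. h \<le> a \<Longrightarrow> a < b \<Longrightarrow> b \<le> t \<Longrightarrow> q a < q b \<and> g (q a) < g (q b)"
    and cov: "\<And>j. j < m \<Longrightarrow> g j < g m \<Longrightarrow>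
      j \<le> q h \<or> (\<exists>a. h \<le> a \<and> a \<le> t \<and> j \<le> q a \<and> g (q a) \<le> g j)"
    using assms(1) unfolding mono_queue_def by auto
  have "?q a < ?q b \<and> g (?q a) < g (?q b)" if "h \<le> a" "a < b" "b \<le> Suc t" for a b
  proof (cases "b = Suc t")
    case True
    have "g (q a) \<le> g (q t)" using inc[of a t] that True by (cases "a = t") auto
    then show ?thesis using True that lt[of a] assms(2) by auto
  qed (use inc[of a b] that in auto)
  moreover have "j \<le> ?q h \<or> (\<exists>a. h \<le> a \<and> a \<le> Suc t \<and> j \<le> ?q a \<and> g (?q a) \<le> g j)" if "j < Suc m" for j
  proof (cases "j < m \<and> g j < g m")
    case True
    then consider "j \<le> q h" | a where "h \<le> a" "a \<le> t" "j \<le> q a" "g (q a) \<le> g j"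
      using cov by blast
    then show ?thesis
    proof cases
      case 2
      then show ?thesis by (intro disjI2 exI[of _ a]) auto
    qed (use ht in auto)
  next
    case False
    then have "j = m \<or> g m \<le> g j" using that by auto
    then show ?thesis using ht that by (intro disjI2 exI[of _ "Suc t"]) auto
  qed
  moreover have "?q a < Suc m" if "h \<le> a" "a \<le> Suc t" for a
    using lt[of a] that by (cases "a = Suc t") auto
  ultimately show ?thesis using ht unfolding mono_queue_def by auto
qed

section \<open>Reasoning about programs\<close>

text \<open>The postcondition also receives the running time, so termination, correctness and cost
  are proved together.\<close>

definition wp :: "com \<Rightarrow> (nat \<Rightarrow> store \<Rightarrow> bool) \<Rightarrow> store \<Rightarrow> bool" where
  "wp c Q s \<longleftrightarrow> (\<exists>t s'. exec c s t s' \<and> Q t s')"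

lemma wp_NAssign:
  "Q (1 + ncost i + ncost e) (write_nat x (nval i s) (nval e s) s) \<Longrightarrow> wp (NAssign x i e) Q s"
  unfolding wp_def using exec.NAssign by blast

lemma wp_RAssign:
  "Q (1 + ncost i + rcost e) (write_real x (nval i s) (rval e s) s) \<Longrightarrow> wp (RAssign x i e) Q s"
  unfolding wp_def using exec.RAssign by blast

lemma wp_Skip: "Q 1 s \<Longrightarrow> wp Skip Q s"
  unfolding wp_def using exec.Skip by blast

lemma wp_Seq: "wp c1 (\<lambda>t1. wp c2 (\<lambda>t2. Q (t1 + t2))) s \<Longrightarrow> wp (Seq c1 c2) Q s"
  unfolding wp_def using exec.Seq by blast

lemma wp_Cond:
  "(bval b s \<Longrightarrow> wp c1 (\<lambda>t. Q (1 + bcost b + t)) s) \<Longrightarrow>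
   (\<not> bval b s \<Longrightarrow> wp c2 (\<lambda>t. Q (1 + bcost b + t)) s) \<Longrightarrow> wp (Cond b c1 c2) Q s"
  unfolding wp_def using exec.CondTrue exec.CondFalse by blast

lemmas wp_intros = wp_NAssign wp_RAssign wp_Skip wp_Seq wp_Cond

text \<open>The potential \<open>\<Phi>\<close> pays for the running time and, since every test costs something, is
  also the termination measure.\<close>

lemma wp_While:
  assumes "I s"
    and step: "\<And>s. I s \<Longrightarrow> bval b s \<Longrightarrow> wp c (\<lambda>t s'. I s' \<and> 1 + bcost b + t + \<Phi> s' \<le> \<Phi> s) s"
    and post: "\<And>t s'. I s' \<Longrightarrow> \<not> bval b s' \<Longrightarrow> t + \<Phi> s' \<le> \<Phi> s + 1 + bcost b \<Longrightarrow> Q t s'"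
  shows "wp (While b c) Q s"
proof -
  have "\<exists>t s'. exec (While b c) s t s' \<and> I s' \<and> \<not> bval b s' \<and> t + \<Phi> s' \<le> \<Phi> s + 1 + bcost b"
    using assms(1)
  proof (induction "\<Phi> s" arbitrary: s rule: less_induct)
    case less
    show ?case
    proof (cases "bval b s")
      case True
      obtain t1 s1 where 1: "exec c s t1 s1" "I s1" "1 + bcost b + t1 + \<Phi> s1 \<le> \<Phi> s"
        using step[OF less.prems True] unfolding wp_def by blast
      then obtain t2 s2 where 2: "exec (While b c) s1 t2 s2" "I s2" "\<not> bval b s2"
          "t2 + \<Phi> s2 \<le> \<Phi> s1 + 1 + bcost b"
        using less.hyps[of s1] by auto
      have "exec (While b c) s (1 + bcost b + t1 + t2) s2"
        using exec.WhileTrue[OF True 1(1) 2(1)] .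
      then show ?thesis using 1 2 by (intro exI[of _ "1 + bcost b + t1 + t2"] exI[of _ s2]) auto
    next
      case False
      then show ?thesis using exec.WhileFalse[OF False] less.prems by (metis add.assoc add.commute order_refl)
    qed
  qed
  then show ?thesis unfolding wp_def using post by blast
qed

lemma nats_write_nat [simp]:
  "nats (write_nat x i v s) = (nats s)(x := (nats s x)(i := v))"
  "nats (write_real x i w s) = nats s"
  by (simp_all add: write_nat_def write_real_def)

lemma reals_write_real [simp]:
  "reals (write_real x i w s) = (reals s)(x := (reals s x)(i := w))"
  "reals (write_nat x i v s) = reals s"
  by (simp_all add: write_nat_def write_real_def)

lemma write_nat_write_nat [simp]: "write_nat x i v (write_nat x i w s) = write_nat x i v s"
  by (simp add: write_nat_def)

lemma write_nat_same [simp]: "write_nat x i (nats s x i) s = s"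
  by (simp add: write_nat_def)

section \<open>The program\<close>

abbreviation nvar :: "vname \<Rightarrow> nexp" where
  "nvar x \<equiv> NCell x (NConst 0)"

abbreviation set_nvar :: "vname \<Rightarrow> nexp \<Rightarrow> com" where
  "set_nvar x \<equiv> NAssign x (NConst 0)"

abbreviation key :: "nexp \<Rightarrow> rexp" where
  "key e \<equiv> RAdd (RCell ''s'' e) (RCell ''f'' e)"

text \<open>The test looks at the second entry: the front is always admissible and is dropped only
  when its successor is admissible too.\<close>

definition pop_front :: com where
  "pop_front = While
     (BAnd (NLess (nvar ''h'') (nvar ''t''))
        (BNot (RLess (RCell ''s'' (nvar ''i'')) (key (NCell ''q'' (NAdd (nvar ''h'') (NConst 1)))))))
     (set_nvar ''h'' (NAdd (nvar ''h'') (NConst 1)))"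

text \<open>No emptiness test is needed: the key of the front is at most \<open>S i\<close>, which is less than the
  key of \<open>i\<close>, so the front acts as a sentinel.\<close>

definition pop_back :: com where
  "pop_back = While
     (BNot (RLess (key (NCell ''q'' (nvar ''t''))) (key (nvar ''i''))))
     (set_nvar ''t'' (NSub (nvar ''t'') (NConst 1)))"

definition insert_index :: com where
  "insert_index =
     Seq (RAssign ''f'' (nvar ''i'')
           (RSub (RCell ''s'' (nvar ''i'')) (RCell ''s'' (NCell ''q'' (nvar ''h'')))))
    (Seq pop_back
    (Seq (set_nvar ''t'' (NAdd (nvar ''t'') (NConst 1)))
         (NAssign ''q'' (nvar ''t'') (nvar ''i''))))"

definition scan_body :: com where
  "scan_body =
     Seq (RAssign ''s'' (NAdd (nvar ''i'') (NConst 1))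
           (RAdd (RCell ''s'' (nvar ''i'')) (RCell ''l'' (nvar ''i''))))
    (Seq (set_nvar ''i'' (NAdd (nvar ''i'') (NConst 1)))
    (Seq pop_front insert_index))"

definition scan :: com where
  "scan = While (NLess (nvar ''i'') (nvar ''n'')) scan_body"

definition minimise_body :: com where
  "minimise_body =
     Seq (RAssign ''m'' (NConst 0) (RSub (RCell ''s'' (nvar ''n'')) (RCell ''s'' (nvar ''j''))))
    (Seq (Cond (RLess (RCell ''m'' (NConst 0)) (RCell ''f'' (nvar ''j'')))
           (RAssign ''m'' (NConst 0) (RCell ''f'' (nvar ''j''))) Skip)
    (Seq (Cond (RLess (RCell ''m'' (NConst 0)) (RCell ''out'' (NConst 0)))
           (RAssign ''out'' (NConst 0) (RCell ''m'' (NConst 0))) Skip)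
         (set_nvar ''j'' (NAdd (nvar ''j'') (NConst 1)))))"

definition minimise :: com where
  "minimise = Seq (RAssign ''out'' (NConst 0) (RCell ''s'' (nvar ''n'')))
     (While (NLess (nvar ''j'') (nvar ''n'')) minimise_body)"

section \<open>Correctness and amortised cost of the queue operations\<close>

text \<open>Each pass costs at most 40 and removes one entry, so the queue length pays for it; the
  additional 40 covers the final failing test.\<close>

lemma wp_pop_front:
  fixes s :: store
  defines "g \<equiv> \<lambda>k. reals s ''s'' k + reals s ''f'' k"
    and "x \<equiv> reals s ''s'' (nats s ''i'' 0)" and "q \<equiv> nats s ''q''" and "t \<equiv> nats s ''t'' 0"
  assumes "mono_queue g m J q (nats s ''h'' 0) t" "g (q (nats s ''h'' 0)) \<le> x"
    and post: "\<And>k h. mono_queue g m J q h t \<Longrightarrow> g (q h) \<le> x \<Longrightarrow> (h < t \<Longrightarrow> x < g (q (Suc h))) \<Longrightarrow>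
      k + 40 * (t - h) \<le> 40 * (t - nats s ''h'' 0) + 40 \<Longrightarrow> Q k (write_nat ''h'' 0 h s)"
  shows "wp pop_front Q s"
  unfolding pop_front_def
proof (rule wp_While[where \<Phi> = "\<lambda>s'. 40 * (t - nats s' ''h'' 0)" and
      I = "\<lambda>s'. \<exists>h. s' = write_nat ''h'' 0 h s \<and> mono_queue g m J q h t \<and> g (q h) \<le> x"],
    goal_cases)
  case 1
  then show ?case using assms by (intro exI[of _ "nats s ''h'' 0"]) auto
next
  case (2 s')
  then obtain h where h: "s' = write_nat ''h'' 0 h s" "mono_queue g m J q h t" by blast
  have "h < t" "g (q (Suc h)) \<le> x" using 2(2) by (simp_all add: h(1) g_def x_def q_def t_def)
  then show ?case
    using mono_queue_pop_front[OF h(2)] by (intro wp_intros) (auto simp: h(1))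
next
  case (3 k s')
  then obtain h where h: "s' = write_nat ''h'' 0 h s" "mono_queue g m J q h t" "g (q h) \<le> x" by blast
  have "x < g (q (Suc h))" if "h < t"
    using 3(2) that by (simp add: h(1) g_def x_def q_def t_def)
  then show ?case using post[OF h(2,3)] 3(3) by (simp add: h(1))
qed

lemma wp_pop_back:
  fixes s :: store
  defines "g \<equiv> \<lambda>k. reals s ''s'' k + reals s ''f'' k"
    and "q \<equiv> nats s ''q''" and "h \<equiv> nats s ''h'' 0" and "m \<equiv> nats s ''i'' 0"
  assumes mq: "mono_queue g m {j. j < m \<and> g j < g m} q h (nats s ''t'' 0)"
    and front: "g (q h) < g m"
    and post: "\<And>k t. mono_queue g m {j. j < m \<and> g j < g m} q h t \<Longrightarrow> g (q t) < g m \<Longrightarrow>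
      k + 40 * (t - h) \<le> 40 * (nats s ''t'' 0 - h) + 40 \<Longrightarrow> Q k (write_nat ''t'' 0 t s)"
  shows "wp pop_back Q s"
  unfolding pop_back_def
proof (rule wp_While[where \<Phi> = "\<lambda>s'. 40 * (nats s' ''t'' 0 - h)" and
      I = "\<lambda>s'. \<exists>t. s' = write_nat ''t'' 0 t s \<and> mono_queue g m {j. j < m \<and> g j < g m} q h t"],
    goal_cases)
  case 1
  then show ?case using mq by (intro exI[of _ "nats s ''t'' 0"]) auto
next
  case (2 s')
  then obtain t where t: "s' = write_nat ''t'' 0 t s" "mono_queue g m {j. j < m \<and> g j < g m} q h t"
    by blast
  have gt: "g m \<le> g (q t)" using 2(2) by (simp add: t(1) g_def q_def m_def)
  \<comment> \<open>The sentinel at work: the test fails at the front, so \<open>t\<close> never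
    drops below \<open>h\<close>.\<close>
  then have "t \<noteq> h" using front by auto
  then have "h < t" using t(2) by (auto simp: mono_queue_def)
  then show ?case
    using mono_queue_pop_back[OF t(2) gt] by (intro wp_intros) (auto simp: t(1))
next
  case (3 k s')
  then obtain t where t: "s' = write_nat ''t'' 0 t s" "mono_queue g m {j. j < m \<and> g j < g m} q h t"
    by blast
  have "g (q t) < g m" using 3(2) by (simp add: t(1) g_def q_def m_def)
  then show ?case using post[OF t(2)] 3(3) by (simp add: t(1))
qed

text \<open>The 120 covers the final test of \<open>pop_back\<close>, a deposit of 40 for the new
  entry, and the three assignments.\<close>

lemma wp_insert_index:
  fixes s :: store
  defines "i \<equiv> nats s ''i'' 0" and "S \<equiv> reals s ''s''" and "f \<equiv> reals s ''f''"
    and "q \<equiv> nats s ''q''" and "h \<equiv> nats s ''h'' 0" and "t \<equiv> nats s ''t'' 0"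
  defines "f' \<equiv> f(i := S i - S (q h))"
  assumes mq: "mono_queue (\<lambda>k. S k + f k) i {..<i} q h t"
    and front: "S (q h) + f (q h) \<le> S i" "S (q h) < S i"
    and post: "\<And>k t'. h < t' \<Longrightarrow>
      mono_queue (\<lambda>k. S k + f' k) (Suc i) {..<Suc i} (q(t' := i)) h t' \<Longrightarrow>
      k + 40 * (t' - h) \<le> 40 * (t - h) + 120 \<Longrightarrow>
      Q k (write_nat ''q'' t' i (write_nat ''t'' 0 t' (write_real ''f'' i (f' i) s)))"
  shows "wp insert_index Q s"
proof -
  let ?g = "\<lambda>k. S k + f' k" and ?s = "write_real ''f'' i (f' i) s"
  have qh: "q h < i" using mq by (auto simp: mono_queue_def)
  have "mono_queue ?g i {..<i} q h t"
    by (rule mono_queue_cong[OF mq]) (simp add: f'_def)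
  then have mq': "mono_queue ?g i {j. j < i \<and> ?g j < ?g i} q h t"
    by (auto simp: mono_queue_def)
  \<comment> \<open>The key of the front is at most \<open>S i\<close>, and the new
    \<open>f' i = S i - S (q h)\<close> is positive.\<close>
  have front': "?g (q h) < ?g i" using qh front by (simp add: f'_def)
  have s: "reals ?s ''s'' = S" "reals ?s ''f'' = f'" "nats ?s = nats s"
    by (simp_all add: S_def f'_def f_def)
  have "wp pop_back (\<lambda>k. wp (Seq (set_nvar ''t'' (NAdd (nvar ''t'') (NConst 1)))
      (NAssign ''q'' (nvar ''t'') (nvar ''i''))) (\<lambda>k'. Q (11 + (k + k')))) ?s"
  proof (rule wp_pop_back, unfold s, fold i_def q_def h_def t_def, rule mq', rule front')
    fix k t'
    assume mq'': "mono_queue ?g i {j. j < i \<and> ?g j < ?g i} q h t'" and "?g (q t') < ?g i"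
      and k: "k + 40 * (t' - h) \<le> 40 * (t - h) + 40"
    then have "mono_queue ?g (Suc i) {..<Suc i} (q(Suc t' := i)) h (Suc t')"
      by (intro mono_queue_push)
    moreover have "h \<le> t'" using mq'' by (simp add: mono_queue_def)
    ultimately show "wp (Seq (set_nvar ''t'' (NAdd (nvar ''t'') (NConst 1)))
      (NAssign ''q'' (nvar ''t'') (nvar ''i''))) (\<lambda>k'. Q (11 + (k + k'))) (write_nat ''t'' 0 t' ?s)"
      using post[of "Suc t'"] k by (intro wp_intros) (simp add: i_def[symmetric])
  qed
  then show ?thesis
    unfolding insert_index_def
    by (intro wp_Seq wp_RAssign) (simp add: i_def f'_def S_def q_def h_def eval_nat_numeral)
qed

section \<open>The scan over the prefixes\<close>

text \<open>The queue already covers \<open>i\<close> itself, ready for the next round. The last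
  conjunct keeps the front admissible, as \<open>pop_front\<close> requires.\<close>

definition scan_inv :: "real list \<Rightarrow> store \<Rightarrow> bool" where
  "scan_inv ls s \<longleftrightarrow> (let i = nats s ''i'' 0; S = reals s ''s''; f = reals s ''f'' in
     i \<le> length ls \<and> nats s ''n'' 0 = length ls \<and> nats s ''j'' 0 = 0 \<and>
     (\<forall>k<length ls. reals s ''l'' k = ls ! k) \<and> (\<forall>k\<le>i. S k = prefix_sum ls k) \<and>
     last_blocks S f i \<and>
     mono_queue (\<lambda>k. S k + f k) (Suc i) {..<Suc i} (nats s ''q'') (nats s ''h'' 0) (nats s ''t'' 0) \<and>
     S (nats s ''q'' (nats s ''h'' 0)) + f (nats s ''q'' (nats s ''h'' 0)) \<le> S i)"

lemma last_blocks_cong: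
  "last_blocks S f n \<Longrightarrow> (\<And>k. k \<le> n \<Longrightarrow> S' k = S k) \<Longrightarrow> (\<And>k. k \<le> n \<Longrightarrow> f' k = f k) \<Longrightarrow>
    last_blocks S' f' n"
  unfolding last_blocks_def
proof (elim conjE, intro conjI ballI, goal_cases)
  case (2 i)
  then obtain p where "p < i" "f i = S i - S p" "S p + f p \<le> S i" "\<forall>j<i. S j + f j \<le> S i \<longrightarrow> j \<le> p"
    by blast
  then show ?case using 2 by (intro exI[of _ p]) auto
qed simp

lemma last_blocks_Suc:
  "last_blocks S f n \<Longrightarrow> p \<le> n \<Longrightarrow> f (Suc n) = S (Suc n) - S p \<Longrightarrow> S p + f p \<le> S (Suc n) \<Longrightarrow>
    (\<And>j. j \<le> n \<Longrightarrow> S j + f j \<le> S (Suc n) \<Longrightarrow> j \<le> p) \<Longrightarrow> last_blocks S f (Suc n)"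
  unfolding last_blocks_def by (auto simp: atLeastAtMostSuc_conv less_Suc_eq_le)

text \<open>Amortised constant cost: 18 for the two leading assignments, 40 beyond the queue
  potential for \<open>pop_front\<close> and 120 for \<open>insert_index\<close>, rounded up to
  200.\<close>

lemma wp_scan_body:
  assumes inv: "scan_inv ls s" and i: "nats s ''i'' 0 < length ls" and pos: "\<forall>l\<in>set ls. 0 < l"
  shows "wp scan_body (\<lambda>k s'. scan_inv ls s' \<and> nats s' ''i'' 0 = Suc (nats s ''i'' 0) \<and>
    k + 40 * (nats s' ''t'' 0 - nats s' ''h'' 0) \<le> 40 * (nats s ''t'' 0 - nats s ''h'' 0) + 200) s"
proof -
  define i S f q h t where d: "i = nats s ''i'' 0" "S = reals s ''s''" "f = reals s ''f''"
    "q = nats s ''q''" "h = nats s ''h'' 0" "t = nats s ''t'' 0"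
  note inv' = inv[unfolded scan_inv_def Let_def, folded d]
  define x where "x = S i + reals s ''l'' i"
  define S' where "S' = S(Suc i := x)"
  have x: "x = prefix_sum ls (Suc i)" using inv' i by (simp add: x_def prefix_sum_Suc d)
  have S': "S' k = prefix_sum ls k" if "k \<le> Suc i" for k
    using that inv' x by (auto simp: S'_def le_Suc_eq)
  have Si: "S i < x"
    using inv' i prefix_sum_strict_mono[OF pos, of i "Suc i"] x by (simp add: d)
  \<comment> \<open>At \<open>Suc i\<close> this still uses the old content of \<open>f\<close>, but
    the queue holds only indices up to \<open>i\<close>.\<close>
  define g where "g = (\<lambda>k. S' k + f k)"
  have g_old: "g k = S k + f k" if "k < Suc i" for k using that by (simp add: g_def S'_def)
  have mq: "mono_queue g (Suc i) {..<Suc i} q h t"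
    using inv' by (intro mono_queue_cong[OF _ g_old]) auto
  have qh: "q h < Suc i" using mq by (auto simp: mono_queue_def)
  have "S (q h) + f (q h) \<le> S i" using inv' by blast
  then have front: "g (q h) \<le> x" using Si qh by (simp add: g_old)
  define s1 where "s1 = write_nat ''i'' 0 (Suc i) (write_real ''s'' (Suc i) x s)"
  have s1: "reals s1 ''s'' = S'" "reals s1 ''f'' = f" "nats s1 ''q'' = q" "nats s1 ''h'' 0 = h"
    "nats s1 ''t'' 0 = t" "nats s1 ''i'' 0 = Suc i" "S' (Suc i) = x"
    by (simp_all add: s1_def S'_def d)
  have "wp pop_front (\<lambda>k. wp insert_index (\<lambda>k' s'. scan_inv ls s' \<and> nats s' ''i'' 0 = Suc i \<and>
      18 + (k + k') + 40 * (nats s' ''t'' 0 - nats s' ''h'' 0) \<le> 40 * (t - h) + 200)) s1"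
  proof (rule wp_pop_front[where m = "Suc i" and J = "{..<Suc i}"], unfold s1, fold g_def,
      rule mq, use front in \<open>simp add: g_def\<close>)
    fix k h'
    assume mq1: "mono_queue g (Suc i) {..<Suc i} q h' t" and front1: "S' (q h') + f (q h') \<le> x"
      and out: "h' < t \<Longrightarrow> x < S' (q (Suc h')) + f (q (Suc h'))"
      and k: "k + 40 * (t - h') \<le> 40 * (t - h) + 40"
    let ?s = "write_nat ''h'' 0 h' s1" and ?f = "f(Suc i := x - S' (q h'))"
    have s2: "nats ?s ''h'' 0 = h'" "nats ?s ''i'' 0 = Suc i" "nats ?s ''q'' = q"
      "nats ?s ''t'' 0 = t" "reals ?s = reals s1"
      using s1 by simp_all
    have qh': "q h' < Suc i" using mq1 by (auto simp: mono_queue_def)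
    have less: "S' (q h') < x"
      using prefix_sum_strict_mono[OF pos qh'] i S' qh' x by (simp add: d)
    \<comment> \<open>The front left by \<open>pop_front\<close> is the largest admissible index,
      that is, the \<open>p\<close> of the recurrence.\<close>
    have lb: "last_blocks S' ?f (Suc i)"
    proof (rule last_blocks_Suc)
      show "last_blocks S' ?f i"
        using inv' by (intro last_blocks_cong[of S f i S' ?f]) (auto simp: S'_def)
      show "j \<le> q h'" if "j \<le> i" "S' j + ?f j \<le> S' (Suc i)" for j
        using mono_queue_front[OF mq1, of x j] out that s1 by (auto simp: g_def)
    qed (use qh' front1 s1 in auto)
    show "wp insert_index (\<lambda>k' s'. scan_inv ls s' \<and> nats s' ''i'' 0 = Suc i \<and>
      18 + (k + k') + 40 * (nats s' ''t'' 0 - nats s' ''h'' 0) \<le> 40 * (t - h) + 200) ?s"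
    proof (rule wp_insert_index, unfold s2 s1, rule mq1[unfolded g_def], rule front1, rule less)
      fix k' t'
      assume ht': "h' < t'"
        and mq2: "mono_queue (\<lambda>k. S' k + ?f k) (Suc (Suc i)) {..<Suc (Suc i)} (q(t' := Suc i)) h' t'"
        and k': "k' + 40 * (t' - h') \<le> 40 * (t - h') + 120"
      let ?s' = "write_nat ''q'' t' (Suc i) (write_nat ''t'' 0 t' (write_real ''f'' (Suc i) (?f (Suc i)) ?s))"
      have n: "nats ?s' ''q'' = q(t' := Suc i)" "nats ?s' ''h'' 0 = h'" "nats ?s' ''t'' 0 = t'"
        "nats ?s' ''i'' 0 = Suc i" "nats ?s' ''n'' = nats s ''n''" "nats ?s' ''j'' = nats s ''j''"
        "reals ?s' ''s'' = S'" "reals ?s' ''f'' = ?f" "reals ?s' ''l'' = reals s ''l''"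
        using s1 by (simp_all add: s1_def)
      have "Suc i \<le> length ls" using i by (simp add: d(1))
      \<comment> \<open>By \<open>h' < t'\<close> the push leaves the front cell intact.\<close>
      moreover have "S' ((q(t' := Suc i)) h') + ?f ((q(t' := Suc i)) h') \<le> S' (Suc i)"
        using ht' front1 qh' s1 by simp
      ultimately have "scan_inv ls ?s'"
        unfolding scan_inv_def Let_def n using inv' S' lb mq2 by blast
      then show "scan_inv ls ?s' \<and> nats ?s' ''i'' 0 = Suc i \<and>
          18 + (k + k') + 40 * (nats ?s' ''t'' 0 - nats ?s' ''h'' 0) \<le> 40 * (t - h) + 200"
        unfolding n using k k' by simp
    qed
  qed
  then show ?thesis
    unfolding scan_body_def
    by (intro wp_Seq wp_RAssign wp_NAssign) (simp add: s1_def x_def d)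
qed

text \<open>The potential combines 300 per remaining segment with 40 per queue entry behind the
  front; the latter part is initially zero.\<close>

lemma wp_scan:
  assumes "scan_inv ls s" "\<forall>l\<in>set ls. 0 < l" "nats s ''t'' 0 = 0"
    and "\<And>k s'. scan_inv ls s' \<Longrightarrow> nats s' ''i'' 0 = length ls \<Longrightarrow> k \<le> 300 * length ls + 10 \<Longrightarrow> Q k s'"
  shows "wp scan Q s"
  unfolding scan_def
proof (rule wp_While[where I = "scan_inv ls" and
      \<Phi> = "\<lambda>s. 300 * (length ls - nats s ''i'' 0) + 40 * (nats s ''t'' 0 - nats s ''h'' 0)"], goal_cases)
  case 1
  then show ?case using assms by simp
next
  case (2 s)
  then have i: "nats s ''i'' 0 < length ls" by (simp add: scan_inv_def Let_def)
  show ?case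
    using wp_scan_body[OF 2(1) i assms(2)] i unfolding wp_def by force
next
  case (3 k s')
  then show ?case using assms(3) by (intro assms(4)) (auto simp: scan_inv_def Let_def)
qed

section \<open>Minimising over the start of the final block\<close>

lemma wp_minimise:
  fixes s :: store
  defines "n \<equiv> nats s ''n'' 0" and "S \<equiv> reals s ''s''" and "f \<equiv> reals s ''f''"
  defines "v \<equiv> \<lambda>j. max (f j) (S n - S j)"
  assumes "nats s ''j'' 0 = 0" "n > 0" "S 0 = 0" "f 0 = 0" "S n \<ge> 0"
    and post: "\<And>k s'. reals s' ''out'' 0 = Min (v ` {..<n}) \<Longrightarrow> k \<le> 100 * n + 20 \<Longrightarrow> Q k s'"
  shows "wp minimise Q s"
proof -
  \<comment> \<open>The seed \<open>S n\<close>, the length of the unfolded ruler, makes the minimum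
    meaningful at \<open>j = 0\<close>. It equals \<open>v 0\<close> because \<open>f 0 = 0\<close>,
    so it does not affect the final value.\<close>
  define M where "M j = Min (insert (S n) (v ` {..<j}))" for j
  have M_Suc: "M (Suc j) = min (v j) (M j)" for j
    by (simp add: M_def lessThan_Suc insert_commute[of "S n"])
  have v0: "v 0 = S n" using assms by (simp add: v_def)
  show ?thesis
    unfolding minimise_def
  proof (intro wp_Seq wp_RAssign, rule wp_While[where \<Phi> = "\<lambda>s. 100 * (n - nats s ''j'' 0)" and
        I = "\<lambda>s. nats s ''n'' 0 = n \<and> reals s ''s'' = S \<and> reals s ''f'' = f \<and>
          nats s ''j'' 0 \<le> n \<and> reals s ''out'' 0 = M (nats s ''j'' 0)"], goal_cases)
    case 1
    then show ?case using assms(5) by (simp add: M_def n_def S_def f_def)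
  next
    case (2 s')
    define j where "j = nats s' ''j'' 0"
    have s': "nats s' ''n'' 0 = n" "reals s' ''s'' = S" "reals s' ''f'' = f"
      "reals s' ''out'' 0 = M j" "j < n" "nats s' ''j'' 0 = j"
      using 2 by (simp_all add: j_def)
    show ?case unfolding minimise_body_def
      by (intro wp_intros) (simp_all add: s' M_Suc, use s'(5) in \<open>auto simp: v_def\<close>)
  next
    case (3 k s')
    have "insert (S n) (v ` {..<n}) = v ` {..<n}"
      using v0 assms(6) by (intro insert_absorb image_eqI[of _ _ 0]) auto
    then show ?case using 3 assms(5) by (intro post) (auto simp: n_def M_def)
  qed
qed

lemma linear_bigo_n_ln_n: "(\<lambda>n. real (a * n + b)) \<in> O(\<lambda>n. real n * ln (real n))"
proof (rule bigoI[where c = "real (a + b)"], rule eventually_sequentiallyI[of 3])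
  fix n :: nat assume n: "3 \<le> n"
  \<comment> \<open>The threshold 3 comes from \<open>exp 1 \<le> 3\<close>.\<close>
  have "1 \<le> ln (real n)"
    using n exp_le by (subst ln_ge_iff) (auto intro: order_trans)
  then have "real n * 1 \<le> real n * ln (real n)" by (intro mult_left_mono) auto
  moreover have "a * n + b \<le> (a + b) * n" using n by (cases n) (auto simp: algebra_simps)
  then have "real (a * n + b) \<le> real (a + b) * real n" by (metis of_nat_le_iff of_nat_mult)
  ultimately show "norm (real (a * n + b)) \<le> real (a + b) * norm (real n * ln (real n))"
    by simp (smt (verit, best) mult_left_mono of_nat_0_le_iff)
qed

theorem theorem2:
  "\<exists>(prog :: com) (T :: nat \<Rightarrow> nat).
     (\<lambda>n. real (T n)) \<in> O(\<lambda>n. real n * ln (real n)) \<and>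
     (\<forall>ls :: real list. ls \<noteq> [] \<and> (\<forall>l \<in> set ls. 0 < l) \<longrightarrow>
        (\<exists>t s. exec prog (input_store ls) t s \<and> t \<le> T (length ls) \<and>
               output_of s = shortest_wrapping ls))"
proof (rule exI[of _ "Seq scan minimise"], rule exI[of _ "\<lambda>n. 400 * n + 30"],
    intro conjI allI impI)
  \<comment> \<open>The bound is the sum of \<open>300 * n + 10\<close> for the scan and
    \<open>100 * n + 20\<close> for the minimisation.\<close>
  show "(\<lambda>n. real (400 * n + 30)) \<in> O(\<lambda>n. real n * ln (real n))"
    by (rule linear_bigo_n_ln_n)
next
  fix ls :: "real list" assume ls: "ls \<noteq> [] \<and> (\<forall>l \<in> set ls. 0 < l)"
  have "wp (Seq scan minimise) (\<lambda>t s. t \<le> 400 * length ls + 30 \<and> output_of s = shortest_wrapping ls)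
    (input_store ls)"
  proof (rule wp_Seq, rule wp_scan[of ls], goal_cases)
    \<comment> \<open>The zero-initialised store already encodes a queue holding just index 0, with
      \<open>S 0 = f 0 = 0\<close>.\<close>
    case 1
    then show ?case
      by (auto simp: scan_inv_def input_store_def last_blocks_def mono_queue_def)
  next
    case (4 k s)
    then have s: "nats s ''n'' 0 = length ls" "nats s ''j'' 0 = 0"
      "\<And>k. k \<le> length ls \<Longrightarrow> reals s ''s'' k = prefix_sum ls k"
      "last_blocks (reals s ''s'') (reals s ''f'') (length ls)"
      by (auto simp: scan_inv_def Let_def)
    have lb: "last_blocks (prefix_sum ls) (reals s ''f'') (length ls)"
      using s by (intro last_blocks_cong[OF s(4)]) auto
    have "0 \<le> prefix_sum ls (length ls)"
      using prefix_sum_mono[of ls 0 "length ls"] ls by simp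
    moreover have "reals s ''f'' 0 = 0" using lb by (simp add: last_blocks_def)
    moreover have "(\<lambda>j. max (reals s ''f'' j) (reals s ''s'' (length ls) - reals s ''s'' j)) ` {..<length ls} =
      (\<lambda>j. max (reals s ''f'' j) (prefix_sum ls (length ls) - prefix_sum ls j)) ` {..<length ls}"
      using s by (intro image_cong) auto
    ultimately show ?case
      using s ls 4(3) shortest_wrapping_eq[OF lb] by (intro wp_minimise) (auto simp: output_of_def)
  qed (use ls in \<open>auto simp: input_store_def\<close>)
  then show "\<exists>t s. exec (Seq scan minimise) (input_store ls) t s \<and> t \<le> 400 * length ls + 30 \<and>
      output_of s = shortest_wrapping ls"
    unfolding wp_def by blast
qed

end
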